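(* Let $\Phi$ be a consistent theory over RPL$\forall$ such that the term structure $\langle[0,1]_{\mathrm{RPL}},\mathbf{T}^{\Phi}\rangle$ associated to $\Phi$ is a model of $\Phi$. Then $\langle[0,1]_{\mathrm{RPL}},\mathbf{T}^{\Phi}\rangle$ is free on the class of all reduced models of $\Phi$; that is, for every reduced model $\langle[0,1]_{\mathrm{RPL}},\mathbf{N}\rangle$ of $\Phi$ and every $\mathbf{N}$-evaluation $v$, there is a unique homomorphism $g$ from $\langle[0,1]_{\mathrm{RPL}},\mathbf{T}^{\Phi}\rangle$ to $\langle[0,1]_{\mathrm{RPL}},\mathbf{N}\rangle$ such that $g(\overline{x})=v(x)$ for every variable $x$.
   Context: **Logic.** RPL$\forall$ (Rational Pavelka predicate logic) is first-order Łukasiewicz logic with a truth constant $\overline r$ for each rational $r\in[0,1]$. Conventions: $\neg\varphi:=\varphi\to\overline 0$, $\varphi\&\psi:=\neg(\varphi\to\neg\psi)$, $\varphi\leftrightarrow\psi:=(\varphi\to\psi)\&(\psi\to\varphi)$, $(\exists x)\varphi:=\neg(\forall x)\neg\varphi$. On $[0,1]$: $a\to b=\min\{1,1-a+b\}$ and $a\& b=\max\{0,a+b-1\}$. Every predicate language contains a binary predicate symbol $\approx$. Axioms: $\varphi\to(\psi\to\varphi)$; $(\varphi\to\psi)\to((\psi\to\xi)\to(\varphi\to\xi))$; $(\neg\psi\to\neg\varphi)\to(\psi\to\varphi)$ [with instances of the contrapositive form]; $((\varphi\to\psi)\to\psi)\to((\psi\to\varphi)\to\varphi)$; $(\overline r\to\overline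 s)\leftrightarrow\overline{r\to s}$; $(\overline r\&\overline s)\leftrightarrow\overline{r\& s}$; $(\forall x)\varphi(x)\to\varphi(t)$ for $t$ substitutable for $x$ in $\varphi$; $(\forall x)(\xi\to\varphi)\to(\xi\to(\forall x)\varphi)$ for $x$ not free in $\xi$; and the similarity and congruence axioms: (S1) $(\forall x)\,x\approx x$; (S2) $(\forall x)(\forall y)(x\approx y\to y\approx x)$; (S3) $(\forall x)(\forall y)(\forall z)(x\approx y\& y\approx z\to x\approx z)$; (C1) for each $n$-ary function symbol $F$, the universal closure of $x_1\approx y_1\&\cdots\& x_n\approx y_n\to F(x_1,\dots,x_n)\approx F(y_1,\dots,y_n)$; (C2) for each $n$-ary predicate symbol $P$, the universal closure of $x_1\approx y_1\&\cdots\& x_n\approx y_n\to(P(x_1,\dots,x_n)\leftrightarrow P(y_1,\dots,y_n))$. Rules: Modus Ponens and Generalization (from $\varphi$ infer $(\forall x)\varphi$). $\vdash$ denotes provability in this system. A theory is a set of sentences; $\Phi$ is consistent if $\Phi\not\vdash\overline 0$. **Semantics.** A structure $\langle[0,1]_{\mathrm{RPL}},\mathbf M\rangle$ consists of a non-empty domain $M$, a function $P_{\mathbf M}:M^n\to[0,1]$ for each $n$-ary predicate symbol $P$, and a function $F_{\mathbf M}:M^n\to M$ for each $n$-ary function symbol $F$ (constants are $0$-ary function symbols). An $\mathbf M$-evaluation $v$ maps variables to $M$. Values $\|t\|_{\mathbf M,v}\in M$ of terms and truth values $\|\varphi\|_{\mathbf M,v}\in[0,1]$ of formulas are defined recursively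 as usual, with $\overline r$ having value $r$, connectives interpreted by the operations above on the standard real interval $[0,1]$, $\forall$ by infimum and $\exists$ by supremum over $M$. Put $\|\varphi\|_{\mathbf M}=\inf_v\|\varphi\|_{\mathbf M,v}$. A model of $\Phi$ is a structure with $\|\varphi\|_{\mathbf M}=1$ for all $\varphi\in\Phi$, where the axioms S1–S3, C1, C2 are also required to have value $1$. A structure is reduced if its Leibniz congruence is the identity, equivalently if for all $d,e\in M$: $\approx_{\mathbf M}(d,e)=1$ iff $d=e$. **Homomorphism.** A map $g:M\to N$ is a homomorphism from $\langle[0,1]_{\mathrm{RPL}},\mathbf M\rangle$ to $\langle[0,1]_{\mathrm{RPL}},\mathbf N\rangle$ if for all $n$-ary function symbols $F$, $n$-ary predicate symbols $P$ and $d_1,\dots,d_n\in M$: (1) $g(F_{\mathbf M}(d_1,\dots,d_n))=F_{\mathbf N}(g(d_1),\dots,g(d_n))$; (2) $P_{\mathbf M}(d_1,\dots,d_n)=1$ implies $P_{\mathbf N}(g(d_1),\dots,g(d_n))=1$. **Term structure.** The provability degree is $|\varphi|_\Phi=\sup\{r\in[0,1]\cap\mathbb Q\mid\Phi\vdash\overline r\to\varphi\}$. For terms (possibly containing variables), $t_1\sim t_2$ iff $|t_1\approx t_2|_\Phi=1$; this is an equivalence relation and $\overline t$ denotes the class of $t$. The term structure associated to $\Phi$ has domain $T^\Phi$ the set of all $\sim$-classes of terms, with $F_{\mathbf T^\Phi}(\overline{t_1},\dots,\overline{t_n})=\overline{F(t_1,\dots,t_n)}$ and $P_{\mathbf T^\Phi}(\overline{t_1},\dots,\overline{t_n})=|P(t_1,\dots,t_n)|_\Phi$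 (these are well defined). *)

theory Defs
  imports Complex_Main "HOL-Library.FuncSet"
begin

definition luk_imp :: "'a::linordered_field \<Rightarrow> 'a \<Rightarrow> 'a" where
  "luk_imp a b = min 1 (1 - a + b)"

definition luk_conj :: "'a::linordered_field \<Rightarrow> 'a \<Rightarrow> 'a" where
  "luk_conj a b = max 0 (a + b - 1)"

text \<open>The symbols of a language form subsets of the types, so that a language may have no
  function symbols at all. Constants are the function symbols of arity 0.\<close>

record ('f, 'p) language =
  funs :: "'f set"
  preds :: "'p set"
  fun_arity :: "'f \<Rightarrow> nat"
  pred_arity :: "'p \<Rightarrow> nat"
  simsym :: 'p

definition is_language :: "('f, 'p) language \<Rightarrow> bool" where
  "is_language L \<longleftrightarrow> simsym L \<in> preds L \<and> pred_arity L (simsym L) = 2"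

datatype 'f tm = Var nat | Fn 'f "'f tm list"

datatype ('f, 'p) fm =
    Pred 'p "'f tm list"
  | TConst rat
  | Imp "('f, 'p) fm" "('f, 'p) fm"
  | Forall nat "('f, 'p) fm"

primrec wf_tm :: "('f, 'p) language \<Rightarrow> 'f tm \<Rightarrow> bool" where
  "wf_tm L (Var x) \<longleftrightarrow> True"
| "wf_tm L (Fn f ts) \<longleftrightarrow> f \<in> funs L \<and> length ts = fun_arity L f \<and> list_all (wf_tm L) ts"

primrec wf_fm :: "('f, 'p) language \<Rightarrow> ('f, 'p) fm \<Rightarrow> bool" where
  "wf_fm L (Pred p ts) \<longleftrightarrow> p \<in> preds L \<and> length ts = pred_arity L p \<and> list_all (wf_tm L) ts"
| "wf_fm L (TConst r) \<longleftrightarrow> 0 \<le> r \<and> r \<le> 1"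
| "wf_fm L (Imp \<phi> \<psi>) \<longleftrightarrow> wf_fm L \<phi> \<and> wf_fm L \<psi>"
| "wf_fm L (Forall x \<phi>) \<longleftrightarrow> wf_fm L \<phi>"

definition Neg :: "('f, 'p) fm \<Rightarrow> ('f, 'p) fm" where
  "Neg \<phi> = Imp \<phi> (TConst 0)"

definition Conj :: "('f, 'p) fm \<Rightarrow> ('f, 'p) fm \<Rightarrow> ('f, 'p) fm" where
  "Conj \<phi> \<psi> = Neg (Imp \<phi> (Neg \<psi>))"

definition Iff :: "('f, 'p) fm \<Rightarrow> ('f, 'p) fm \<Rightarrow> ('f, 'p) fm" where
  "Iff \<phi> \<psi> = Conj (Imp \<phi> \<psi>) (Imp \<psi> \<phi>)"

definition Exists :: "nat \<Rightarrow> ('f, 'p) fm \<Rightarrow> ('f, 'p) fm" where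
  "Exists x \<phi> = Neg (Forall x (Neg \<phi>))"

definition Sim :: "('f, 'p) language \<Rightarrow> 'f tm \<Rightarrow> 'f tm \<Rightarrow> ('f, 'p) fm" where
  "Sim L s t = Pred (simsym L) [s, t]"

text \<open>The empty conjunction is the truth constant 1; it only arises in the congruence axioms
  for symbols of arity 0.\<close>

fun Conjs :: "('f, 'p) fm list \<Rightarrow> ('f, 'p) fm" where
  "Conjs [] = TConst 1"
| "Conjs [\<phi>] = \<phi>"
| "Conjs (\<phi> # \<psi> # \<phi>s) = Conj \<phi> (Conjs (\<psi> # \<phi>s))"

definition Foralls :: "nat list \<Rightarrow> ('f, 'p) fm \<Rightarrow> ('f, 'p) fm" where
  "Foralls xs \<phi> = foldr Forall xs \<phi>"

primrec vars_tm :: "'f tm \<Rightarrow> nat set" where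
  "vars_tm (Var x) = {x}"
| "vars_tm (Fn f ts) = \<Union> (set (map vars_tm ts))"

primrec fv :: "('f, 'p) fm \<Rightarrow> nat set" where
  "fv (Pred p ts) = \<Union> (set (map vars_tm ts))"
| "fv (TConst r) = {}"
| "fv (Imp \<phi> \<psi>) = fv \<phi> \<union> fv \<psi>"
| "fv (Forall x \<phi>) = fv \<phi> - {x}"

definition sentence :: "('f, 'p) language \<Rightarrow> ('f, 'p) fm \<Rightarrow> bool" where
  "sentence L \<phi> \<longleftrightarrow> wf_fm L \<phi> \<and> fv \<phi> = {}"

definition is_theory :: "('f, 'p) language \<Rightarrow> ('f, 'p) fm set \<Rightarrow> bool" where
  "is_theory L \<Phi> \<longleftrightarrow> (\<forall>\<phi>\<in>\<Phi>. sentence L \<phi>)"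

primrec subst_tm :: "nat \<Rightarrow> 'f tm \<Rightarrow> 'f tm \<Rightarrow> 'f tm" where
  "subst_tm x t (Var y) = (if y = x then t else Var y)"
| "subst_tm x t (Fn f ts) = Fn f (map (subst_tm x t) ts)"

text \<open>Substitution does not rename bound variables; it is only used under \<open>substitutable\<close>.\<close>

primrec subst_fm :: "nat \<Rightarrow> 'f tm \<Rightarrow> ('f, 'p) fm \<Rightarrow> ('f, 'p) fm" where
  "subst_fm x t (Pred p ts) = Pred p (map (subst_tm x t) ts)"
| "subst_fm x t (TConst r) = TConst r"
| "subst_fm x t (Imp \<phi> \<psi>) = Imp (subst_fm x t \<phi>) (subst_fm x t \<psi>)"
| "subst_fm x t (Forall y \<phi>) = (if y = x then Forall y \<phi> else Forall y (subst_fm x t \<phi>))"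

primrec substitutable :: "'f tm \<Rightarrow> nat \<Rightarrow> ('f, 'p) fm \<Rightarrow> bool" where
  "substitutable t x (Pred p ts) \<longleftrightarrow> True"
| "substitutable t x (TConst r) \<longleftrightarrow> True"
| "substitutable t x (Imp \<phi> \<psi>) \<longleftrightarrow> substitutable t x \<phi> \<and> substitutable t x \<psi>"
| "substitutable t x (Forall y \<phi>) \<longleftrightarrow>
     x \<notin> fv (Forall y \<phi>) \<or> (y \<notin> vars_tm t \<and> substitutable t x \<phi>)"

text \<open>The variables in these axioms are schematic: every choice of distinct names is an instance.\<close>

inductive_set sim_axioms :: "('f, 'p) language \<Rightarrow> ('f, 'p) fm set"
  for L :: "('f, 'p) language" where
  S1: "Forall x (Sim L (Var x) (Var x)) \<in> sim_axioms L"
| S2: "distinct [x, y] \<Longrightarrow>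
    Forall x (Forall y (Imp (Sim L (Var x) (Var y)) (Sim L (Var y) (Var x)))) \<in> sim_axioms L"
| S3: "distinct [x, y, z] \<Longrightarrow>
    Forall x (Forall y (Forall z (Imp (Conj (Sim L (Var x) (Var y)) (Sim L (Var y) (Var z)))
      (Sim L (Var x) (Var z))))) \<in> sim_axioms L"
| C1: "\<lbrakk>f \<in> funs L; length xs = fun_arity L f; length ys = fun_arity L f; distinct (xs @ ys)\<rbrakk> \<Longrightarrow>
    Foralls (xs @ ys)
      (Imp (Conjs (map2 (\<lambda>x y. Sim L (Var x) (Var y)) xs ys))
        (Sim L (Fn f (map Var xs)) (Fn f (map Var ys)))) \<in> sim_axioms L"
| C2: "\<lbrakk>p \<in> preds L; length xs = pred_arity L p; length ys = pred_arity L p; distinct (xs @ ys)\<rbrakk> \<Longrightarrow>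
    Foralls (xs @ ys)
      (Imp (Conjs (map2 (\<lambda>x y. Sim L (Var x) (Var y)) xs ys))
        (Iff (Pred p (map Var xs)) (Pred p (map Var ys)))) \<in> sim_axioms L"

inductive_set log_axioms :: "('f, 'p) fm set" where
  L1: "Imp \<phi> (Imp \<psi> \<phi>) \<in> log_axioms"
| L2: "Imp (Imp \<phi> \<psi>) (Imp (Imp \<psi> \<xi>) (Imp \<phi> \<xi>)) \<in> log_axioms"
| L3: "Imp (Imp (Neg \<phi>) (Neg \<psi>)) (Imp \<psi> \<phi>) \<in> log_axioms"
| L4: "Imp (Imp (Imp \<phi> \<psi>) \<psi>) (Imp (Imp \<psi> \<phi>) \<phi>) \<in> log_axioms"
| R1: "Iff (Imp (TConst r) (TConst s)) (TConst (luk_imp r s)) \<in> log_axioms"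
| R2: "Iff (Conj (TConst r) (TConst s)) (TConst (luk_conj r s)) \<in> log_axioms"
| Q1: "substitutable t x \<phi> \<Longrightarrow> Imp (Forall x \<phi>) (subst_fm x t \<phi>) \<in> log_axioms"
| Q2: "x \<notin> fv \<xi> \<Longrightarrow> Imp (Forall x (Imp \<xi> \<phi>)) (Imp \<xi> (Forall x \<phi>)) \<in> log_axioms"

text \<open>Only axiom instances that are formulas of the language are admitted; in \<open>R1\<close> and \<open>R2\<close>
  this also restricts the truth constants to the unit interval.\<close>

inductive provable :: "('f, 'p) language \<Rightarrow> ('f, 'p) fm set \<Rightarrow> ('f, 'p) fm \<Rightarrow> bool"
  for L :: "('f, 'p) language" and \<Phi> :: "('f, 'p) fm set" where
  Hyp: "\<phi> \<in> \<Phi> \<Longrightarrow> provable L \<Phi> \<phi>"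
| LogAx: "\<lbrakk>\<phi> \<in> log_axioms; wf_fm L \<phi>\<rbrakk> \<Longrightarrow> provable L \<Phi> \<phi>"
| SimAx: "\<phi> \<in> sim_axioms L \<Longrightarrow> provable L \<Phi> \<phi>"
| MP: "\<lbrakk>provable L \<Phi> \<phi>; provable L \<Phi> (Imp \<phi> \<psi>)\<rbrakk> \<Longrightarrow> provable L \<Phi> \<psi>"
| Gen: "provable L \<Phi> \<phi> \<Longrightarrow> provable L \<Phi> (Forall x \<phi>)"

definition consistent :: "('f, 'p) language \<Rightarrow> ('f, 'p) fm set \<Rightarrow> bool" where
  "consistent L \<Phi> \<longleftrightarrow> \<not> provable L \<Phi> (TConst 0)"

definition prov_degree :: "('f, 'p) language \<Rightarrow> ('f, 'p) fm set \<Rightarrow> ('f, 'p) fm \<Rightarrow> real" where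
  "prov_degree L \<Phi> \<phi> =
     Sup {real_of_rat r | r. 0 \<le> r \<and> r \<le> 1 \<and> provable L \<Phi> (Imp (TConst r) \<phi>)}"

record ('f, 'p, 'm) fstruct =
  dom :: "'m set"
  finterp :: "'f \<Rightarrow> 'm list \<Rightarrow> 'm"
  pinterp :: "'p \<Rightarrow> 'm list \<Rightarrow> real"

definition is_structure :: "('f, 'p) language \<Rightarrow> ('f, 'p, 'm) fstruct \<Rightarrow> bool" where
  "is_structure L M \<longleftrightarrow> dom M \<noteq> {} \<and>
     (\<forall>f\<in>funs L. \<forall>ds. set ds \<subseteq> dom M \<and> length ds = fun_arity L f \<longrightarrow> finterp M f ds \<in> dom M) \<and>
     (\<forall>p\<in>preds L. \<forall>ds. set ds \<subseteq> dom M \<and> length ds = pred_arity L p \<longrightarrow> pinterp M p ds \<in> {0..1})"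

definition evaluations :: "('f, 'p, 'm) fstruct \<Rightarrow> (nat \<Rightarrow> 'm) set" where
  "evaluations M = {v. \<forall>x. v x \<in> dom M}"

primrec tm_value :: "('f, 'p, 'm) fstruct \<Rightarrow> (nat \<Rightarrow> 'm) \<Rightarrow> 'f tm \<Rightarrow> 'm" where
  "tm_value M v (Var x) = v x"
| "tm_value M v (Fn f ts) = finterp M f (map (tm_value M v) ts)"

primrec fm_value :: "('f, 'p, 'm) fstruct \<Rightarrow> (nat \<Rightarrow> 'm) \<Rightarrow> ('f, 'p) fm \<Rightarrow> real" where
  "fm_value M v (Pred p ts) = pinterp M p (map (tm_value M v) ts)"
| "fm_value M v (TConst r) = real_of_rat r"
| "fm_value M v (Imp \<phi> \<psi>) = luk_imp (fm_value M v \<phi>) (fm_value M v \<psi>)"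
| "fm_value M v (Forall x \<phi>) = (INF d\<in>dom M. fm_value M (v(x := d)) \<phi>)"

definition truth_value :: "('f, 'p, 'm) fstruct \<Rightarrow> ('f, 'p) fm \<Rightarrow> real" where
  "truth_value M \<phi> = (INF v\<in>evaluations M. fm_value M v \<phi>)"

definition is_model ::
  "('f, 'p) language \<Rightarrow> ('f, 'p) fm set \<Rightarrow> ('f, 'p, 'm) fstruct \<Rightarrow> bool" where
  "is_model L \<Phi> M \<longleftrightarrow> is_structure L M \<and> (\<forall>\<phi>\<in>\<Phi> \<union> sim_axioms L. truth_value M \<phi> = 1)"

definition reduced :: "('f, 'p) language \<Rightarrow> ('f, 'p, 'm) fstruct \<Rightarrow> bool" where
  "reduced L M \<longleftrightarrow>
     (\<forall>d\<in>dom M. \<forall>e\<in>dom M. pinterp M (simsym L) [d, e] = 1 \<longleftrightarrow> d = e)"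

text \<open>A map between domains is a function that is \<open>undefined\<close> outside the source domain, so that
  equality of such functions is equality of maps.\<close>

definition is_hom ::
  "('f, 'p) language \<Rightarrow> ('f, 'p, 'm) fstruct \<Rightarrow> ('f, 'p, 'n) fstruct \<Rightarrow> ('m \<Rightarrow> 'n) \<Rightarrow> bool"
where
  "is_hom L M N g \<longleftrightarrow> g \<in> dom M \<rightarrow>\<^sub>E dom N \<and>
     (\<forall>f\<in>funs L. \<forall>ds. set ds \<subseteq> dom M \<and> length ds = fun_arity L f \<longrightarrow>
        g (finterp M f ds) = finterp N f (map g ds)) \<and>
     (\<forall>p\<in>preds L. \<forall>ds. set ds \<subseteq> dom M \<and> length ds = pred_arity L p \<longrightarrow>
        pinterp M p ds = 1 \<longrightarrow> pinterp N p (map g ds) = 1)"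

definition tm_equiv :: "('f, 'p) language \<Rightarrow> ('f, 'p) fm set \<Rightarrow> ('f tm \<times> 'f tm) set" where
  "tm_equiv L \<Phi> = {(s, t). wf_tm L s \<and> wf_tm L t \<and> prov_degree L \<Phi> (Sim L s t) = 1}"

definition tm_class :: "('f, 'p) language \<Rightarrow> ('f, 'p) fm set \<Rightarrow> 'f tm \<Rightarrow> 'f tm set" where
  "tm_class L \<Phi> t = tm_equiv L \<Phi> `` {t}"

text \<open>The descriptions below are determined on lists of classes whose length is the arity, because
  the operations do not depend on the choice of the representatives \<open>ts\<close>.\<close>

definition term_structure ::
  "('f, 'p) language \<Rightarrow> ('f, 'p) fm set \<Rightarrow> ('f, 'p, 'f tm set) fstruct" where
  "term_structure L \<Phi> =
     \<lparr>dom = {t. wf_tm L t} // tm_equiv L \<Phi>,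
      finterp = (\<lambda>f cs. THE c. \<exists>ts. list_all (wf_tm L) ts \<and> map (tm_class L \<Phi>) ts = cs \<and>
        c = tm_class L \<Phi> (Fn f ts)),
      pinterp = (\<lambda>p cs. THE a. \<exists>ts. list_all (wf_tm L) ts \<and> map (tm_class L \<Phi>) ts = cs \<and>
        a = prov_degree L \<Phi> (Pred p ts))\<rparr>"

lemma tm_value_in_dom:
  assumes "is_structure L M" "v \<in> evaluations M"
  shows "wf_tm L t \<Longrightarrow> tm_value M v t \<in> dom M"
proof (induction t)
  case (Var x)
  then show ?case using assms by (simp add: evaluations_def)
next
  case (Fn f ts)
  then have "set (map (tm_value M v) ts) \<subseteq> dom M" by (auto simp: list_all_iff)
  with Fn.prems assms(1) show ?case by (simp add: is_structure_def)
qed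

lemma fm_value_bounds:
  assumes "is_structure L M"
  shows "wf_fm L \<phi> \<Longrightarrow> v \<in> evaluations M \<Longrightarrow> fm_value M v \<phi> \<in> {0..1}"
proof (induction \<phi> arbitrary: v)
  case (Pred p ts)
  then have "set (map (tm_value M v) ts) \<subseteq> dom M"
    using tm_value_in_dom[OF assms] by (auto simp: list_all_iff)
  with Pred.prems assms show ?case by (simp add: is_structure_def)
next
  case (TConst r)
  then show ?case by simp
next
  case (Imp \<phi> \<psi>)
  from Imp.IH(1)[of v] Imp.IH(2)[of v] Imp.prems show ?case by (simp add: luk_imp_def)
next
  case (Forall x \<phi>)
  obtain d0 where d0: "d0 \<in> dom M" using assms by (auto simp: is_structure_def)
  have *: "fm_value M (v(x := d)) \<phi> \<in> {0..1}" if "d \<in> dom M" for d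
    using that Forall by (simp add: evaluations_def)
  have "0 \<le> (INF d\<in>dom M. fm_value M (v(x := d)) \<phi>)"
    using * d0 by (intro cINF_greatest) auto
  moreover have "(INF d\<in>dom M. fm_value M (v(x := d)) \<phi>) \<le> fm_value M (v(x := d0)) \<phi>"
    using * d0 by (intro cINF_lower bdd_belowI2[where m = 0]) auto
  ultimately show ?case using *[OF d0] by simp
qed

lemma fm_value_Neg:
  assumes "is_structure L M" "wf_fm L \<phi>" "v \<in> evaluations M"
  shows "fm_value M v (Neg \<phi>) = 1 - fm_value M v \<phi>"
  using fm_value_bounds[OF assms] by (simp add: Neg_def luk_imp_def)

lemma fm_value_Conj:
  assumes "is_structure L M" "wf_fm L \<phi>" "wf_fm L \<psi>" "v \<in> evaluations M"
  shows "fm_value M v (Conj \<phi> \<psi>) = luk_conj (fm_value M v \<phi>) (fm_value M v \<psi>)"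
  using fm_value_bounds[OF assms(1,2,4)] fm_value_bounds[OF assms(1,3,4)]
  by (simp add: Conj_def Neg_def luk_imp_def luk_conj_def min_def max_def)

lemma fm_value_Exists:
  assumes "is_structure L M" "wf_fm L \<phi>" "v \<in> evaluations M"
  shows "fm_value M v (Exists x \<phi>) = (SUP d\<in>dom M. fm_value M (v(x := d)) \<phi>)"
proof -
  let ?h = "\<lambda>d. fm_value M (v(x := d)) \<phi>"
  have ne: "dom M \<noteq> {}" using assms(1) by (simp add: is_structure_def)
  have ev: "v(x := d) \<in> evaluations M" if "d \<in> dom M" for d
    using that assms(3) by (simp add: evaluations_def)
  have h: "?h d \<in> {0..1}" if "d \<in> dom M" for d
    using fm_value_bounds[OF assms(1,2) ev[OF that]] .
  have bdd: "bdd_above (?h ` dom M)" using h by (intro bdd_aboveI2[where M = 1]) auto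
  have "fm_value M v (Forall x (Neg \<phi>)) = (INF d\<in>dom M. 1 - ?h d)"
    by (simp add: fm_value_Neg[OF assms(1,2) ev])
  also have "\<dots> = 1 - (SUP d\<in>dom M. ?h d)"
  proof (rule antisym)
    have "(SUP d\<in>dom M. ?h d) \<le> 1 - (INF d\<in>dom M. 1 - ?h d)"
    proof (rule cSUP_least[OF ne])
      fix d assume d: "d \<in> dom M"
      have "(INF d\<in>dom M. 1 - ?h d) \<le> 1 - ?h d"
        using h d by (intro cINF_lower bdd_belowI2[where m = 0]) auto
      then show "?h d \<le> 1 - (INF d\<in>dom M. 1 - ?h d)" by simp
    qed
    then show "(INF d\<in>dom M. 1 - ?h d) \<le> 1 - (SUP d\<in>dom M. ?h d)" by simp
    show "1 - (SUP d\<in>dom M. ?h d) \<le> (INF d\<in>dom M. 1 - ?h d)"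
      using cSUP_upper[OF _ bdd] by (intro cINF_greatest[OF ne]) simp
  qed
  finally show ?thesis
    using fm_value_Neg[OF assms(1) _ assms(3), of "Forall x (Neg \<phi>)"] assms(2)
    by (simp add: Exists_def Neg_def)
qed

end

theory Submission imports Defs begin

text \<open>The homomorphism is forced to send the class of a term to its value in \<open>N\<close> under \<open>v\<close>. Two
  things make this work. The formulas of provability degree 1 contain all theorems and are closed
  under modus ponens, because \<open>r & r\<close> tends to 1 as \<open>r\<close> does; applied to instances of the
  similarity and congruence axioms at fresh variables, this makes the operations of the term
  structure independent of representatives. By soundness a formula of provability degree 1 has
  value 1 in \<open>N\<close>, so equivalent terms have similar values in \<open>N\<close>, and these are equal because \<open>N\<close>
  is reduced.\<close>

section \<open>Soundness\<close>

lemma tm_value_cong: "(\<And>x. x \<in> vars_tm t \<Longrightarrow> v x = w x) \<Longrightarrow> tm_value M v t = tm_value M w t"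
proof (induction t)
  case (Fn f ts)
  then have "map (tm_value M v) ts = map (tm_value M w) ts" by auto
  then show ?case by (simp only: tm_value.simps)
qed simp

lemma fm_value_cong: "(\<And>x. x \<in> fv \<phi> \<Longrightarrow> v x = w x) \<Longrightarrow> fm_value M v \<phi> = fm_value M w \<phi>"
proof (induction \<phi> arbitrary: v w)
  case (Pred p ts)
  then have "map (tm_value M v) ts = map (tm_value M w) ts" by (auto intro!: tm_value_cong)
  then show ?case by (simp only: fm_value.simps)
next
  case (Imp \<phi> \<psi>)
  from Imp.IH(1)[of v w] Imp.IH(2)[of v w] Imp.prems show ?case by simp
next
  case (Forall y \<phi>)
  have "fm_value M (v(y := d)) \<phi> = fm_value M (w(y := d)) \<phi>" for d
    by (rule Forall.IH) (use Forall.prems in auto)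
  then show ?case by simp
qed simp

lemma tm_value_subst: "tm_value M v (subst_tm x t s) = tm_value M (v(x := tm_value M v t)) s"
proof (induction s)
  case (Fn f ts)
  then have "map (tm_value M v \<circ> subst_tm x t) ts = map (tm_value M (v(x := tm_value M v t))) ts"
    by (auto simp del: fun_upd_apply)
  then show ?case by (simp only: tm_value.simps subst_tm.simps map_map)
qed simp

lemma subst_tm_notin: "x \<notin> vars_tm s \<Longrightarrow> subst_tm x t s = s"
  by (induction s) (auto intro!: map_idI)

lemma subst_fm_notin: "x \<notin> fv \<phi> \<Longrightarrow> subst_fm x t \<phi> = \<phi>"
  by (induction \<phi>) (auto intro!: map_idI subst_tm_notin)

text \<open>\<open>substitutable\<close> excludes capture: if \<open>x\<close> is free in
  \<open>Forall y \<phi>\<close>, then \<open>y\<close> does not occur in \<open>t\<close>, so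
  updating \<open>y\<close> leaves the value of \<open>t\<close> unchanged. If \<open>x\<close> is
  not free there, the substitution is vacuous.\<close>

lemma fm_value_subst:
  "substitutable t x \<phi> \<Longrightarrow> fm_value M v (subst_fm x t \<phi>) = fm_value M (v(x := tm_value M v t)) \<phi>"
proof (induction \<phi> arbitrary: v)
  case (Pred p ts)
  have "map (tm_value M v \<circ> subst_tm x t) ts = map (tm_value M (v(x := tm_value M v t))) ts"
    by (auto simp: tm_value_subst)
  then show ?case by (simp only: fm_value.simps subst_fm.simps map_map)
next
  case (Forall y \<phi>)
  show ?case
  proof (cases "x \<in> fv (Forall y \<phi>)")
    case False
    then have "fm_value M (v(x := tm_value M v t)) (Forall y \<phi>) = fm_value M v (Forall y \<phi>)"
      by (intro fm_value_cong) auto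
    then show ?thesis using subst_fm_notin[OF False, of t] by (simp only:)
  next
    case True
    with Forall.prems have y: "y \<notin> vars_tm t" "substitutable t x \<phi>" "y \<noteq> x" by auto
    have "fm_value M (v(y := d)) (subst_fm x t \<phi>) = fm_value M (v(x := tm_value M v t, y := d)) \<phi>" for d
    proof -
      have "tm_value M (v(y := d)) t = tm_value M v t" using y by (intro tm_value_cong) auto
      then show ?thesis using Forall.IH[OF y(2), of "v(y := d)"] y(3)
        by (simp add: fun_upd_twist del: fun_upd_apply)
    qed
    then show ?thesis using y(3) by (simp del: fun_upd_apply)
  qed
qed simp_all

section \<open>Well-formedness of substitution instances and theorems\<close>

lemma wf_subst_tm_imp: "wf_tm L (subst_tm x t s) \<Longrightarrow> x \<in> vars_tm s \<Longrightarrow> wf_tm L t"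
  by (induction s) (auto simp: list_all_iff split: if_splits)

text \<open>For instances of \<open>Q1\<close> only the whole axiom is known to be well-formed; when
  \<open>x\<close> is free, \<open>t\<close> occurs in it and inherits this.\<close>

lemma wf_subst_fm_imp: "wf_fm L (subst_fm x t \<phi>) \<Longrightarrow> x \<in> fv \<phi> \<Longrightarrow> wf_tm L t"
  by (induction \<phi>) (auto simp: list_all_iff split: if_splits dest: wf_subst_tm_imp)

lemma wf_subst_tm: "wf_tm L t \<Longrightarrow> wf_tm L s \<Longrightarrow> wf_tm L (subst_tm x t s)"
  by (induction s) (auto simp: list_all_iff)

lemma wf_subst_fm: "wf_tm L t \<Longrightarrow> wf_fm L \<phi> \<Longrightarrow> wf_fm L (subst_fm x t \<phi>)"
  by (induction \<phi>) (auto simp: list_all_iff wf_subst_tm)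

lemma wf_Neg [simp]: "wf_fm L (Neg \<phi>) \<longleftrightarrow> wf_fm L \<phi>"
  by (simp add: Neg_def)

lemma wf_Conj [simp]: "wf_fm L (Conj \<phi> \<psi>) \<longleftrightarrow> wf_fm L \<phi> \<and> wf_fm L \<psi>"
  by (simp add: Conj_def)

lemma wf_Iff [simp]: "wf_fm L (Iff \<phi> \<psi>) \<longleftrightarrow> wf_fm L \<phi> \<and> wf_fm L \<psi>"
  by (auto simp: Iff_def)

lemma wf_Sim [simp]: "is_language L \<Longrightarrow> wf_fm L (Sim L s t) \<longleftrightarrow> wf_tm L s \<and> wf_tm L t"
  by (auto simp: Sim_def is_language_def)

lemma wf_Conjs: "(\<And>\<phi>. \<phi> \<in> set \<phi>s \<Longrightarrow> wf_fm L \<phi>) \<Longrightarrow> wf_fm L (Conjs \<phi>s)"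
  by (induction \<phi>s rule: Conjs.induct) auto

lemma wf_Foralls [simp]: "wf_fm L (Foralls xs \<phi>) \<longleftrightarrow> wf_fm L \<phi>"
  by (induction xs) (auto simp: Foralls_def)

lemma wf_sim_axioms: "\<phi> \<in> sim_axioms L \<Longrightarrow> is_language L \<Longrightarrow> wf_fm L \<phi>"
  by (induction rule: sim_axioms.induct)
    (auto simp: list_all_iff intro!: wf_Conjs dest!: set_zip_leftD)

text \<open>For modus ponens, the consequent is part of a well-formed implication.
  \<open>SimAx\<close> carries no well-formedness premise, so \<open>wf_sim_axioms\<close> supplies
  it.\<close>

lemma provable_wf:
  assumes "is_language L" "is_theory L \<Phi>"
  shows "provable L \<Phi> \<phi> \<Longrightarrow> wf_fm L \<phi>"
  by (induction rule: provable.induct)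
    (use assms in \<open>auto simp: wf_sim_axioms is_theory_def sentence_def\<close>)

section \<open>Validity of the logical axioms\<close>

lemma luk_imp_eq_1_iff: "luk_imp a b = 1 \<longleftrightarrow> a \<le> b"
  by (auto simp: luk_imp_def min_def)

text \<open>Truth constants are rational while truth values are real, so \<open>R1\<close> needs the
  embedding to respect the implication. It preserves order, hence both minima take the same
  branch.\<close>

lemma of_rat_luk_imp: "real_of_rat (luk_imp r s) = luk_imp (real_of_rat r) (real_of_rat s)"
proof -
  have "1 \<le> 1 - real_of_rat r + real_of_rat s \<longleftrightarrow> 1 \<le> 1 - r + s"
    by (simp add: algebra_simps of_rat_less_eq)
  then show ?thesis by (simp add: luk_imp_def min_def of_rat_add of_rat_diff)
qed

lemma of_rat_luk_conj: "real_of_rat (luk_conj r s) = luk_conj (real_of_rat r) (real_of_rat s)"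
proof -
  have "0 \<le> real_of_rat r + real_of_rat s - 1 \<longleftrightarrow> 0 \<le> r + s - 1"
    using of_rat_less_eq[of 0 "r + s - 1", where 'a = real]
    by (simp add: of_rat_add of_rat_diff)
  then show ?thesis by (simp add: luk_conj_def max_def of_rat_add of_rat_diff)
qed

lemma fm_value_Iff_eq_1:
  assumes "is_structure L M" "wf_fm L \<phi>" "wf_fm L \<psi>" "v \<in> evaluations M"
    and "fm_value M v \<phi> = fm_value M v \<psi>"
  shows "fm_value M v (Iff \<phi> \<psi>) = 1"
  using assms by (simp add: Iff_def fm_value_Conj luk_conj_def luk_imp_def)

text \<open>The bounds 0 and 1 on all values turn the propositional axioms into piecewise linear
  arithmetic; \<open>Q1\<close> and \<open>Q2\<close> become properties of infima.\<close>

lemma fm_value_log_axioms: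
  assumes M: "is_structure L M"
  shows "\<phi> \<in> log_axioms \<Longrightarrow> wf_fm L \<phi> \<Longrightarrow> v \<in> evaluations M \<Longrightarrow> fm_value M v \<phi> = 1"
proof (induction rule: log_axioms.induct)
  case (L1 \<phi> \<psi>)
  with fm_value_bounds[OF M, of \<phi> v] fm_value_bounds[OF M, of \<psi> v]
  show ?case by (auto simp: luk_imp_def)
next
  case (L2 \<phi> \<psi> \<xi>)
  with fm_value_bounds[OF M, of \<phi> v] fm_value_bounds[OF M, of \<psi> v] fm_value_bounds[OF M, of \<xi> v]
  show ?case by (auto simp: luk_imp_def min_def)
next
  case (L3 \<phi> \<psi>)
  with fm_value_bounds[OF M, of \<phi> v] fm_value_bounds[OF M, of \<psi> v]
  show ?case by (auto simp: fm_value_Neg[OF M] luk_imp_def)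
next
  case (L4 \<phi> \<psi>)
  with fm_value_bounds[OF M, of \<phi> v] fm_value_bounds[OF M, of \<psi> v]
  show ?case by (auto simp: luk_imp_def min_def)
next
  case (R1 r s)
  have "fm_value M v (Imp (TConst r) (TConst s)) = fm_value M v (TConst (luk_imp r s))"
    by (simp add: of_rat_luk_imp)
  with R1 show ?case by (intro fm_value_Iff_eq_1[OF M]) auto
next
  case (R2 r s)
  then have "fm_value M v (Conj (TConst r) (TConst s)) = fm_value M v (TConst (luk_conj r s))"
    by (subst fm_value_Conj[OF M]) (auto simp: of_rat_luk_conj)
  with R2 show ?case by (intro fm_value_Iff_eq_1[OF M]) auto
next
  case (Q1 t x \<phi>)
  have "(INF d\<in>dom M. fm_value M (v(x := d)) \<phi>) \<le> fm_value M v (subst_fm x t \<phi>)"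
  proof -
    \<comment> \<open>The witness is the value of \<open>t\<close> if \<open>x\<close> is free in
      the formula. Otherwise \<open>t\<close> may be ill-formed and have a value outside the domain;
      then \<open>v x\<close> serves, since the substitution is vacuous.\<close>
    obtain e where e: "e \<in> dom M" "fm_value M v (subst_fm x t \<phi>) = fm_value M (v(x := e)) \<phi>"
    proof (cases "x \<in> fv \<phi>")
      case True
      with Q1.prems have "wf_tm L t" by (auto dest: wf_subst_fm_imp)
      with that show thesis using tm_value_in_dom[OF M] fm_value_subst Q1 by blast
    next
      case False
      then have "fm_value M v (subst_fm x t \<phi>) = fm_value M (v(x := v x)) \<phi>"
        by (simp add: subst_fm_notin)
      then show thesis using that[of "v x"] Q1.prems(2) by (simp add: evaluations_def)
    qed
    have "fm_value M (v(x := d)) \<phi> \<in> {0..1}" if "d \<in> dom M" for d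
      using that Q1.prems by (intro fm_value_bounds[OF M]) (auto simp: evaluations_def)
    then have "bdd_below ((\<lambda>d. fm_value M (v(x := d)) \<phi>) ` dom M)"
      by (intro bdd_belowI2[where m = 0]) auto
    then show ?thesis using e cINF_lower by (simp only:)
  qed
  then show ?case by (simp add: luk_imp_eq_1_iff)
next
  case (Q2 x \<xi> \<phi>)
  define a where "a = fm_value M v \<xi>"
  define h where "h = (\<lambda>d. fm_value M (v(x := d)) \<phi>)"
  have ne: "dom M \<noteq> {}" using M by (simp add: is_structure_def)
  have h: "h d \<in> {0..1}" if "d \<in> dom M" for d
    unfolding h_def using that Q2.prems by (intro fm_value_bounds[OF M]) (auto simp: evaluations_def)
  have a: "a \<in> {0..1}" unfolding a_def using Q2.prems by (intro fm_value_bounds[OF M]) auto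
  have xi: "fm_value M (v(x := d)) \<xi> = a" for d
    unfolding a_def using Q2.hyps by (intro fm_value_cong) auto
  have low: "(INF d\<in>dom M. luk_imp a (h d)) \<le> luk_imp a (h d)" if "d \<in> dom M" for d
    using that a h by (intro cINF_lower bdd_belowI2[where m = 0]) (auto simp: luk_imp_def)
  \<comment> \<open>Each implication has value at most \<open>1 - a + h d\<close>; moving
    \<open>1 - a\<close> to the left gives a common lower bound of all \<open>h d\<close>.\<close>
  have "(INF d\<in>dom M. luk_imp a (h d)) - 1 + a \<le> (INF d\<in>dom M. h d)"
    using low by (intro cINF_greatest[OF ne]) (force simp: luk_imp_def)
  \<comment> \<open>Any element of the domain bounds the infimum of the implications by 1, the other
    branch of the minimum.\<close>
  moreover obtain d0 where "d0 \<in> dom M" using ne by blast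
  ultimately have "(INF d\<in>dom M. luk_imp a (h d)) \<le> luk_imp a (INF d\<in>dom M. h d)"
    using low[of d0] by (simp add: luk_imp_def)
  then show ?case unfolding h_def by (simp add: luk_imp_eq_1_iff xi flip: a_def)
qed

lemma fm_value_eq_1_if_truth_value:
  assumes M: "is_structure L M" and "wf_fm L \<phi>" "truth_value M \<phi> = 1" "v \<in> evaluations M"
  shows "fm_value M v \<phi> = 1"
proof -
  have b: "fm_value M w \<phi> \<in> {0..1}" if "w \<in> evaluations M" for w
    using fm_value_bounds[OF M] assms that by blast
  have "truth_value M \<phi> \<le> fm_value M v \<phi>"
    unfolding truth_value_def using assms b by (intro cINF_lower bdd_belowI2[where m = 0]) auto
  then show ?thesis using assms b[of v] by simp
qed

text \<open>The evaluation stays arbitrary in the induction because generalization uses its premise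
  at every \<open>v(x := d)\<close>.\<close>

lemma soundness:
  assumes "is_language L" "is_theory L \<Phi>" "is_model L \<Phi> M"
  shows "provable L \<Phi> \<phi> \<Longrightarrow> v \<in> evaluations M \<Longrightarrow> fm_value M v \<phi> = 1"
proof (induction arbitrary: v rule: provable.induct)
  have M: "is_structure L M" using assms(3) by (simp add: is_model_def)
  note wf = provable_wf[OF assms(1,2)]
  {
    case (Hyp \<phi>)
    with assms show ?case
      by (intro fm_value_eq_1_if_truth_value[OF M]) (auto intro: wf provable.Hyp simp: is_model_def)
  next
    case (LogAx \<phi>)
    then show ?case using fm_value_log_axioms[OF M] by blast
  next
    case (SimAx \<phi>)
    with assms show ?case
      by (intro fm_value_eq_1_if_truth_value[OF M]) (auto intro: wf provable.SimAx simp: is_model_def)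
  next
    case (MP \<phi> \<psi>)
    \<comment> \<open>Detachment only bounds the value from below by 1; the upper bound comes from
      well-formedness.\<close>
    have "fm_value M v \<psi> \<le> 1"
      using wf[OF MP.hyps(2)] fm_value_bounds[OF M, of \<psi> v] MP.prems by simp
    with MP show ?case by (force simp: luk_imp_eq_1_iff)
  next
    case (Gen \<phi> x)
    have "fm_value M (v(x := d)) \<phi> = 1" if "d \<in> dom M" for d
      using Gen that by (simp add: evaluations_def)
    then show ?case using M by (simp add: is_structure_def)
  }
qed

section \<open>Derivations in Lukasiewicz logic\<close>

locale rpl_theory =
  fixes L :: "('f, 'p) language" and \<Phi> :: "('f, 'p) fm set"
  assumes lang: "is_language L" and thy: "is_theory L \<Phi>"
begin

abbreviation wf :: "('f, 'p) fm \<Rightarrow> bool" where "wf \<equiv> wf_fm L"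

abbreviation prv :: "('f, 'p) fm \<Rightarrow> bool" where "prv \<equiv> provable L \<Phi>"

lemmas prv_wf = provable_wf[OF lang thy]

lemma prv_K: "wf A \<Longrightarrow> wf B \<Longrightarrow> prv (Imp A (Imp B A))"
  by (rule LogAx[OF log_axioms.L1]) simp

lemma prv_B: "wf A \<Longrightarrow> wf B \<Longrightarrow> wf C \<Longrightarrow> prv (Imp (Imp A B) (Imp (Imp B C) (Imp A C)))"
  by (rule LogAx[OF log_axioms.L2]) simp

lemma prv_trans: "prv (Imp A B) \<Longrightarrow> prv (Imp B C) \<Longrightarrow> prv (Imp A C)"
  using prv_wf[of "Imp A B"] prv_wf[of "Imp B C"] prv_B[of A B C]
  by (auto intro: MP[OF _ MP])

text \<open>Weakening gives \<open>Imp A (Imp (Imp B A) A)\<close>, and \<open>L4\<close> exchanges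
  the roles of \<open>A\<close> and \<open>B\<close>.\<close>

lemma prv_assertion:
  assumes "wf A" "wf B"
  shows "prv (Imp A (Imp (Imp A B) B))"
proof (rule prv_trans)
  show "prv (Imp A (Imp (Imp B A) A))" using assms by (simp add: prv_K)
  show "prv (Imp (Imp (Imp B A) A) (Imp (Imp A B) B))"
    by (rule LogAx[OF log_axioms.L4]) (use assms in simp)
qed

lemma prv_exchange:
  assumes "wf A" "wf B" "wf C"
  shows "prv (Imp (Imp A (Imp B C)) (Imp B (Imp A C)))"
proof (rule prv_trans)
  show "prv (Imp (Imp A (Imp B C)) (Imp (Imp (Imp B C) C) (Imp A C)))"
    using assms by (simp add: prv_B)
  \<comment> \<open>This is \<open>L2\<close> applied to the assertion
    \<open>Imp B (Imp (Imp B C) C)\<close>.\<close>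
  show "prv (Imp (Imp (Imp (Imp B C) C) (Imp A C)) (Imp B (Imp A C)))"
    by (rule MP[OF prv_assertion prv_B]) (use assms in simp_all)
qed

lemma prv_exchange_rule: "prv (Imp A (Imp B C)) \<Longrightarrow> prv (Imp B (Imp A C))"
  using prv_wf[of "Imp A (Imp B C)"] prv_exchange[of A B C] MP by auto

text \<open>Exchanging a weakening gives \<open>Imp B (Imp A A)\<close> for any \<open>B\<close>.
  Taking for \<open>B\<close> the weakening \<open>Imp A (Imp A A)\<close> allows it to be
  detached.\<close>

lemma prv_refl:
  assumes "wf A"
  shows "prv (Imp A A)"
proof -
  have "prv (Imp (Imp A (Imp A A)) (Imp A A))"
    using assms by (intro prv_exchange_rule[OF prv_K]) simp_all
  then show ?thesis using prv_K[of A A] assms MP by blast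
qed

text \<open>By \<open>L3\<close> it suffices to prove \<open>Imp (Neg A) (Neg (TConst 0))\<close>, a
  weakening of \<open>Imp (TConst 0) (TConst 0)\<close>.\<close>

lemma prv_ex_falso:
  assumes "wf A"
  shows "prv (Imp (TConst 0) A)"
proof -
  have "prv (Imp (Neg A) (Neg (TConst 0)))"
    by (rule MP[OF prv_refl prv_K[of "Neg (TConst 0)" "Neg A", unfolded Neg_def[of "TConst 0"]],
          folded Neg_def]) (use assms in simp_all)
  moreover have "prv (Imp (Imp (Neg A) (Neg (TConst 0))) (Imp (TConst 0) A))"
    by (rule LogAx[OF log_axioms.L3]) (use assms in simp)
  ultimately show ?thesis by (rule MP)
qed

text \<open>The double negation is the left side of \<open>L4\<close> with \<open>TConst 0\<close>
  as second formula; ex falso then discharges the remaining premise.\<close>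

lemma prv_double_neg:
  assumes "wf A"
  shows "prv (Imp (Neg (Neg A)) A)"
proof -
  have "prv (Imp (Neg (Neg A)) (Imp (Imp (TConst 0) A) A))"
    unfolding Neg_def by (rule LogAx[OF log_axioms.L4]) (use assms in simp)
  then show ?thesis using prv_exchange_rule prv_ex_falso[OF assms] MP by blast
qed

lemma prv_contrapos: "wf A \<Longrightarrow> wf B \<Longrightarrow> prv (Imp (Imp A B) (Imp (Neg B) (Neg A)))"
  unfolding Neg_def by (rule prv_B) simp_all

text \<open>Since \<open>Conj A B\<close> unfolds to an implication into \<open>TConst 0\<close>,
  this is assertion for \<open>A\<close> and \<open>Neg B\<close> followed by an exchange.\<close>

lemma prv_conjI:
  assumes "wf A" "wf B"
  shows "prv (Imp A (Imp B (Conj A B)))"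
proof (rule prv_trans)
  show "prv (Imp A (Imp (Imp A (Neg B)) (Neg B)))" using assms by (simp add: prv_assertion)
  show "prv (Imp (Imp (Imp A (Neg B)) (Neg B)) (Imp B (Conj A B)))"
    unfolding Conj_def Neg_def by (rule prv_exchange) (use assms in simp_all)
qed

text \<open>Contraposing the inner implication, exchanging and contraposing again yields the double
  negation of \<open>C\<close>.\<close>

lemma prv_uncurry:
  assumes "prv (Imp A (Imp B C))"
  shows "prv (Imp (Conj A B) C)"
proof -
  have wfs: "wf A" "wf B" "wf C" using prv_wf[OF assms] by auto
  have "prv (Imp A (Imp (Neg C) (Neg B)))" by (rule prv_trans[OF assms prv_contrapos]) fact+
  then have "prv (Imp (Neg C) (Imp A (Neg B)))" by (rule prv_exchange_rule)
  then have "prv (Imp (Conj A B) (Neg (Neg C)))"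
    unfolding Conj_def by (rule MP[OF _ prv_contrapos]) (use wfs in simp_all)
  then show ?thesis using prv_trans prv_double_neg wfs by blast
qed

lemma prv_conjE1: "wf A \<Longrightarrow> wf B \<Longrightarrow> prv (Imp (Conj A B) A)"
  by (intro prv_uncurry prv_K)

lemma prv_conjE2: "wf A \<Longrightarrow> wf B \<Longrightarrow> prv (Imp (Conj A B) B)"
  by (intro prv_uncurry prv_exchange_rule[OF prv_K])

lemma prv_IffD2: "prv (Iff A B) \<Longrightarrow> prv (Imp B A)"
  using prv_wf[of "Iff A B"] prv_conjE2[of "Imp A B" "Imp B A"] MP by (auto simp: Iff_def)

lemma prv_IffD1: "prv (Iff A B) \<Longrightarrow> prv (Imp A B)"
  using prv_wf[of "Iff A B"] prv_conjE1[of "Imp A B" "Imp B A"] MP by (auto simp: Iff_def)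

text \<open>\<open>R1\<close> at \<open>r = s = 0\<close> identifies the constant 1 with the theorem
  \<open>Imp (TConst 0) (TConst 0)\<close>.\<close>

lemma prv_TConst_1: "prv (TConst 1)"
proof -
  have "prv (Iff (Imp (TConst 0) (TConst 0)) (TConst (luk_imp 0 0)))"
    by (rule LogAx[OF log_axioms.R1]) (simp add: luk_imp_def)
  then have "prv (Imp (Imp (TConst 0) (TConst 0)) (TConst 1))"
    using prv_IffD1 by (force simp: luk_imp_def)
  then show ?thesis using MP[OF prv_refl[of "TConst 0"]] by simp
qed

text \<open>For \<open>r \<le> s\<close> the value \<open>luk_imp r s\<close> is 1, so
  \<open>R1\<close> reduces the claim to the constant 1.\<close>

lemma prv_TConst_mono:
  assumes "0 \<le> r" "r \<le> s" "s \<le> 1"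
  shows "prv (Imp (TConst r) (TConst s))"
proof -
  have "prv (Iff (Imp (TConst r) (TConst s)) (TConst (luk_imp r s)))"
    by (rule LogAx[OF log_axioms.R1]) (use assms in \<open>simp add: luk_imp_def\<close>)
  then show ?thesis
    using MP[OF prv_TConst_1] prv_IffD2 assms luk_imp_eq_1_iff[of r s] by metis
qed

text \<open>\<open>R2\<close> splits the constant \<open>luk_conj r s\<close> into a conjunction
  whose parts prove \<open>A\<close> and \<open>Imp A B\<close> respectively. This is the
  quantitative form of modus ponens behind all degree estimates.\<close>

lemma prv_graded_MP:
  assumes A: "prv (Imp (TConst r) A)" and AB: "prv (Imp (TConst s) (Imp A B))"
  shows "prv (Imp (TConst (luk_conj r s)) B)"
proof -
  have wfs: "wf A" "wf B" "0 \<le> r" "r \<le> 1" "0 \<le> s" "s \<le> 1"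
    using prv_wf[OF A] prv_wf[OF AB] by auto
  have "prv (Iff (Conj (TConst r) (TConst s)) (TConst (luk_conj r s)))"
    by (rule LogAx[OF log_axioms.R2]) (use wfs in \<open>simp add: luk_conj_def\<close>)
  then have "prv (Imp (TConst (luk_conj r s)) (Conj (TConst r) (TConst s)))" by (rule prv_IffD2)
  moreover have "prv (Imp (TConst r) (Imp (TConst s) B))"
    using prv_trans[OF A prv_exchange_rule[OF AB]] .
  ultimately show ?thesis using prv_trans prv_uncurry by blast
qed

section \<open>Provability degree\<close>

abbreviation degree :: "('f, 'p) fm \<Rightarrow> real" where "degree \<equiv> prov_degree L \<Phi>"

lemma bdd_above_degree:
  "bdd_above {real_of_rat r | r. 0 \<le> r \<and> r \<le> 1 \<and> prv (Imp (TConst r) A)}"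
  by (rule bdd_aboveI[where M = 1]) auto

lemma degree_upper: "prv (Imp (TConst r) A) \<Longrightarrow> real_of_rat r \<le> degree A"
  unfolding prov_degree_def using prv_wf[of "Imp (TConst r) A"]
  by (intro cSup_upper[OF _ bdd_above_degree]) auto

lemma degree_least:
  assumes "wf A" "\<And>r. prv (Imp (TConst r) A) \<Longrightarrow> real_of_rat r \<le> a"
  shows "degree A \<le> a"
  unfolding prov_degree_def
proof (rule cSup_least)
  \<comment> \<open>Ex falso puts \<open>r = 0\<close> into the set.\<close>
  show "{real_of_rat r | r. 0 \<le> r \<and> r \<le> 1 \<and> prv (Imp (TConst r) A)} \<noteq> {}"
    using prv_ex_falso[OF assms(1)] by force
qed (use assms(2) in auto)

lemma degree_le_1: "wf A \<Longrightarrow> degree A \<le> 1"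
  by (rule degree_least) (auto dest!: prv_wf)

text \<open>The supremum 1 need not be attained, hence the strict bound on \<open>r\<close>. The
  provable levels are downward closed, so a level that fails would bound the degree by
  \<open>r\<close>.\<close>

lemma prv_of_degree_eq_1:
  assumes "wf A" "degree A = 1" "0 \<le> r" "r < 1"
  shows "prv (Imp (TConst r) A)"
proof (rule ccontr)
  assume not: "\<not> ?thesis"
  have "real_of_rat s \<le> real_of_rat r" if s: "prv (Imp (TConst s) A)" for s
  proof (rule ccontr)
    assume "\<not> ?thesis"
    then have "prv (Imp (TConst r) (TConst s))"
      using prv_wf[OF s] assms(3) by (intro prv_TConst_mono) (auto simp: of_rat_less_eq)
    then show False using not s prv_trans by blast
  qed
  then have "degree A \<le> real_of_rat r" by (rule degree_least[OF assms(1)])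
  also have "\<dots> < 1" using assms(4) by simp
  finally show False using assms(2) by simp
qed

text \<open>The implication is available at every level below 1, so the level lost in a graded modus
  ponens can be made arbitrarily small.\<close>

lemma degree_mono:
  assumes "wf A" "wf B" "degree (Imp A B) = 1"
  shows "degree A \<le> degree B"
proof (rule degree_least[OF assms(1)])
  fix r assume r: "prv (Imp (TConst r) A)"
  then have r01: "0 \<le> r" "r \<le> 1" using prv_wf by force+
  show "real_of_rat r \<le> degree B"
  proof (rule ccontr)
    assume less: "\<not> ?thesis"
    \<comment> \<open>A rational strictly between the degree of \<open>B\<close> and
      \<open>r\<close>; proving \<open>B\<close> at level \<open>q\<close> is contradictory.\<close>
    then obtain q where q: "degree B < real_of_rat q" "real_of_rat q < real_of_rat r"
      using of_rat_dense[of "degree B" "real_of_rat r"] by auto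
    have "real_of_rat 0 \<le> degree B" by (rule degree_upper[OF prv_ex_falso[OF assms(2)]])
    with q(1) have "real_of_rat 0 < real_of_rat q" by linarith
    with q(2) r01 have q01: "0 < q" "q < r" by (auto simp: of_rat_less)
    \<comment> \<open>This level is below 1 because \<open>q < r\<close>, and its strong conjunction
      with \<open>r\<close> is exactly \<open>q\<close>, with no truncation as
      \<open>q > 0\<close>.\<close>
    have "prv (Imp (TConst (1 - (r - q))) (Imp A B))"
      using assms q01 r01 by (intro prv_of_degree_eq_1) auto
    from prv_graded_MP[OF r this] q01 have "prv (Imp (TConst q) B)"
      by (simp add: luk_conj_def)
    with q(1) degree_upper show False by fastforce
  qed
qed

lemma degree_eq_1_iff_ge: "wf A \<Longrightarrow> degree A = 1 \<longleftrightarrow> 1 \<le> degree A"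
  using degree_le_1 by force

lemma degree_prv:
  assumes "prv A"
  shows "degree A = 1"
proof -
  have wf: "wf A" using assms prv_wf by blast
  have "prv (Imp (TConst 1) A)" by (rule MP[OF assms prv_K]) (use wf in simp_all)
  from degree_upper[OF this] show ?thesis using degree_eq_1_iff_ge[OF wf] by simp
qed

lemma degree_MP:
  assumes "wf A" "wf B" "degree A = 1" "degree (Imp A B) = 1"
  shows "degree B = 1"
  using degree_mono[OF assms(1,2,4)] assms degree_eq_1_iff_ge by simp

lemma degree_MP_prv:
  assumes "prv (Imp A B)" "degree A = 1"
  shows "degree B = 1"
  using prv_wf[OF assms(1)] degree_prv[OF assms(1)] degree_MP[of A B] assms(2) by simp

lemma degree_conj:
  assumes "wf A" "wf B" "degree A = 1" "degree B = 1"
  shows "degree (Conj A B) = 1"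
  by (rule degree_MP[of B]) (use assms degree_MP_prv[OF prv_conjI] in auto)

lemma degree_Conjs:
  "(\<And>A. A \<in> set As \<Longrightarrow> wf A \<and> degree A = 1) \<Longrightarrow> degree (Conjs As) = 1"
proof (induction As rule: Conjs.induct)
  case 1
  show ?case using degree_prv[OF prv_TConst_1] by simp
next
  case (3 A B As)
  then show ?case using degree_conj[of A "Conjs (B # As)"] wf_Conjs[of "B # As" L] by simp
qed simp

end

section \<open>Instances of universal closures\<close>

text \<open>The similarity and congruence axioms are universal closures of such formulas, so only
  the quantifiers of the prefix could capture variables.\<close>

primrec quantifier_free :: "('f, 'p) fm \<Rightarrow> bool" where
  "quantifier_free (Pred p ts) \<longleftrightarrow> True"
| "quantifier_free (TConst r) \<longleftrightarrow> True"
| "quantifier_free (Imp \<phi> \<psi>) \<longleftrightarrow> quantifier_free \<phi> \<and> quantifier_free \<psi>"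
| "quantifier_free (Forall x \<phi>) \<longleftrightarrow> False"

lemma quantifier_free_connectives [simp]:
  "quantifier_free (Neg \<phi>) \<longleftrightarrow> quantifier_free \<phi>"
  "quantifier_free (Conj \<phi> \<psi>) \<longleftrightarrow> quantifier_free \<phi> \<and> quantifier_free \<psi>"
  "quantifier_free (Iff \<phi> \<psi>) \<longleftrightarrow> quantifier_free \<phi> \<and> quantifier_free \<psi>"
  "quantifier_free (Sim L s t)"
  by (auto simp: Neg_def Conj_def Iff_def Sim_def)

lemma quantifier_free_Conjs: "(\<And>\<phi>. \<phi> \<in> set \<phi>s \<Longrightarrow> quantifier_free \<phi>) \<Longrightarrow> quantifier_free (Conjs \<phi>s)"
  by (induction \<phi>s rule: Conjs.induct) auto

lemma quantifier_free_subst [simp]: "quantifier_free (subst_fm x t \<phi>) \<longleftrightarrow> quantifier_free \<phi>"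
  by (induction \<phi>) auto

lemma substitutable_Foralls:
  assumes "quantifier_free \<phi>" "set xs \<inter> vars_tm t = {}"
  shows "substitutable t x (Foralls xs \<phi>)"
proof -
  have "substitutable t x \<phi>" using assms(1) by (induction \<phi>) auto
  with assms(2) show ?thesis by (induction xs) (auto simp: Foralls_def)
qed

lemma subst_Foralls: "x \<notin> set xs \<Longrightarrow> subst_fm x t (Foralls xs \<phi>) = Foralls xs (subst_fm x t \<phi>)"
  by (induction xs) (auto simp: Foralls_def)

text \<open>The substitutions are performed one after another, matching the removal of quantifiers
  from the outside in.\<close>

definition substs_tm :: "(nat \<times> 'f tm) list \<Rightarrow> 'f tm \<Rightarrow> 'f tm" where
  "substs_tm ps = fold (\<lambda>(x, t). subst_tm x t) ps"

definition substs_fm :: "(nat \<times> 'f tm) list \<Rightarrow> ('f, 'p) fm \<Rightarrow> ('f, 'p) fm" where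
  "substs_fm ps = fold (\<lambda>(x, t). subst_fm x t) ps"

lemma substs_tm_Fn [simp]: "substs_tm ps (Fn f ts) = Fn f (map (substs_tm ps) ts)"
  by (induction ps arbitrary: ts) (auto simp: substs_tm_def)

lemma substs_fm_simps [simp]:
  "substs_fm ps (Pred p ts) = Pred p (map (substs_tm ps) ts)"
  "substs_fm ps (TConst r) = TConst r"
  "substs_fm ps (Imp \<phi> \<psi>) = Imp (substs_fm ps \<phi>) (substs_fm ps \<psi>)"
  by (induction ps arbitrary: ts \<phi> \<psi>) (auto simp: substs_fm_def substs_tm_def)

lemma substs_fm_connectives [simp]:
  "substs_fm ps (Neg \<phi>) = Neg (substs_fm ps \<phi>)"
  "substs_fm ps (Conj \<phi> \<psi>) = Conj (substs_fm ps \<phi>) (substs_fm ps \<psi>)"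
  "substs_fm ps (Iff \<phi> \<psi>) = Iff (substs_fm ps \<phi>) (substs_fm ps \<psi>)"
  "substs_fm ps (Sim L s t) = Sim L (substs_tm ps s) (substs_tm ps t)"
  by (auto simp: Neg_def Conj_def Iff_def Sim_def)

lemma substs_fm_Conjs [simp]: "substs_fm ps (Conjs \<phi>s) = Conjs (map (substs_fm ps) \<phi>s)"
  by (induction \<phi>s rule: Conjs.induct) auto

lemma substs_tm_notin: "vars_tm s \<inter> fst ` set ps = {} \<Longrightarrow> substs_tm ps s = s"
  by (induction ps) (auto simp: substs_tm_def subst_tm_notin)

text \<open>Freshness keeps later substitutions from altering terms already inserted, and
  distinctness keeps earlier ones from altering later variables. The sequential substitution thus
  acts as a simultaneous one.\<close>

lemma substs_tm_zip:
  assumes "length ts = length xs" "distinct xs" "set xs \<inter> \<Union> (vars_tm ` set ts) = {}"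
  shows "map (substs_tm (zip xs ts)) (map Var xs) = ts"
  using assms
proof (induction ts xs rule: list_induct2)
  case (Cons t ts x xs)
  have "substs_tm (zip xs ts) t = t"
    using Cons.prems Cons.hyps by (intro substs_tm_notin) (auto dest: set_zip_leftD)
  moreover have "substs_tm (zip (x # xs) (t # ts)) s =
      substs_tm (zip xs ts) (subst_tm x t s)" for s by (simp add: substs_tm_def)
  moreover have "map (subst_tm x t) (map Var xs) = map Var xs"
    using Cons.prems by auto
  moreover have "map (substs_tm (zip xs ts)) (map Var xs) = ts"
    using Cons.prems by (intro Cons.IH) auto
  ultimately show ?case
    unfolding list.map(2) zip_Cons_Cons
    by (metis (no_types, lifting) map_map map_cong comp_apply subst_tm.simps(1))
qed simp

lemma fresh_variables:
  obtains xs :: "nat list" where "length xs = n" "distinct xs" "set xs \<inter> \<Union> (vars_tm ` set ts) = {}"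
proof -
  have "finite (vars_tm t)" for t :: "'a tm" by (induction t) auto
  then have "finite (\<Union> (vars_tm ` set ts))" by blast
  then obtain m where "\<forall>x \<in> \<Union> (vars_tm ` set ts). x < m" by (auto simp: finite_nat_set_iff_bounded)
  \<comment> \<open>A block of consecutive indices starting above every variable that
    occurs.\<close>
  then show thesis by (intro that[of "[m..<m + n]"]) fastforce+
qed

context rpl_theory
begin

text \<open>\<open>Q1\<close> removes the outermost quantifier. The inserted term avoids the
  remaining prefix, so it is substitutable, and by distinctness the substitution passes to the
  matrix.\<close>

lemma prv_instance:
  assumes "length ts = length xs" "prv (Foralls xs \<phi>)" "quantifier_free \<phi>" "distinct xs"
    and "list_all (wf_tm L) ts" "set xs \<inter> \<Union> (vars_tm ` set ts) = {}"
  shows "prv (substs_fm (zip xs ts) \<phi>)"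
  using assms
proof (induction ts xs arbitrary: \<phi> rule: list_induct2)
  case Nil
  then show ?case by (simp add: Foralls_def substs_fm_def)
next
  case (Cons t ts x xs)
  have all: "Foralls (x # xs) \<phi> = Forall x (Foralls xs \<phi>)" by (simp add: Foralls_def)
  have "prv (Imp (Forall x (Foralls xs \<phi>)) (subst_fm x t (Foralls xs \<phi>)))"
  proof (rule LogAx[OF log_axioms.Q1])
    show "substitutable t x (Foralls xs \<phi>)"
      using Cons.prems by (intro substitutable_Foralls) auto
    show "wf (Imp (Forall x (Foralls xs \<phi>)) (subst_fm x t (Foralls xs \<phi>)))"
      using Cons.prems prv_wf[OF Cons.prems(1)] by (auto simp: all intro!: wf_subst_fm)
  qed
  then have "prv (Foralls xs (subst_fm x t \<phi>))"
    using Cons.prems MP by (simp add: all subst_Foralls)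
  then have "prv (substs_fm (zip xs ts) (subst_fm x t \<phi>))"
    using Cons.prems by (intro Cons.IH) auto
  then show ?case by (simp add: substs_fm_def)
qed

text \<open>Serves \<open>C1\<close> and \<open>C2\<close>. The axiom is assumed for all variable
  lists because suitable names are known only once \<open>ss\<close> and \<open>ts\<close> are
  given.\<close>

lemma prv_instance2:
  assumes "\<And>xs ys. length xs = n \<Longrightarrow> length ys = n \<Longrightarrow> distinct (xs @ ys) \<Longrightarrow> prv (Foralls (xs @ ys) (\<phi> xs ys))"
    and "\<And>xs ys. quantifier_free (\<phi> xs ys)"
    and "list_all (wf_tm L) ss" "list_all (wf_tm L) ts" "length ss = n" "length ts = n"
  obtains xs ys \<sigma> where "prv (substs_fm \<sigma> (\<phi> xs ys))" "length xs = n" "length ys = n"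
    "map (substs_tm \<sigma> \<circ> Var) xs = ss" "map (substs_tm \<sigma> \<circ> Var) ys = ts"
proof -
  obtain zs where zs: "length zs = n + n" "distinct zs" "set zs \<inter> \<Union> (vars_tm ` set (ss @ ts)) = {}"
    by (rule fresh_variables)
  \<comment> \<open>Cutting one fresh list in two makes the blocks disjoint from each other as well
    as from the terms.\<close>
  define xs ys where "xs = take n zs" and "ys = drop n zs"
  have zs_eq: "zs = xs @ ys" and len: "length xs = n" "length ys = n"
    using zs(1) by (auto simp: xs_def ys_def)
  have "prv (substs_fm (zip (xs @ ys) (ss @ ts)) (\<phi> xs ys))"
    using assms zs len unfolding zs_eq by (intro prv_instance) auto
  moreover have "map (substs_tm (zip (xs @ ys) (ss @ ts))) (map Var (xs @ ys)) = ss @ ts"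
    using assms zs len unfolding zs_eq by (intro substs_tm_zip) auto
  ultimately show thesis using that[of "zip (xs @ ys) (ss @ ts)" xs ys] len assms(5) by simp
qed

section \<open>The term structure\<close>

lemma map_substs_Sims:
  assumes "length xs = length ys"
  shows "map (substs_fm \<sigma>) (map2 (\<lambda>x y. Sim L (Var x) (Var y)) xs ys) =
    map2 (Sim L) (map (substs_tm \<sigma> \<circ> Var) xs) (map (substs_tm \<sigma> \<circ> Var) ys)"
  using assms by (induction xs ys rule: list_induct2) auto

lemma degree_Sim_refl:
  assumes "wf_tm L t"
  shows "degree (Sim L t t) = 1"
proof -
  obtain xs where xs: "length xs = 1" "distinct xs" "set xs \<inter> \<Union> (vars_tm ` set [t]) = {}"
    by (rule fresh_variables)
  then obtain x where x: "xs = [x]" by (auto simp: length_Suc_conv)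
  have "prv (Foralls xs (Sim L (Var x) (Var x)))"
    by (simp add: x Foralls_def SimAx sim_axioms.S1)
  then have "prv (substs_fm (zip xs [t]) (Sim L (Var x) (Var x)))"
    using xs assms by (intro prv_instance) auto
  moreover have "map (substs_tm (zip xs [t])) (map Var xs) = [t]"
    using xs by (intro substs_tm_zip) auto
  ultimately show ?thesis by (intro degree_prv) (simp add: x)
qed

lemma degree_Sim_sym:
  assumes "wf_tm L s" "wf_tm L t" "degree (Sim L s t) = 1"
  shows "degree (Sim L t s) = 1"
proof -
  obtain xs where xs: "length xs = 2" "distinct xs" "set xs \<inter> \<Union> (vars_tm ` set [s, t]) = {}"
    by (rule fresh_variables)
  then obtain x y where x: "xs = [x, y]" by (auto simp: length_Suc_conv numeral_2_eq_2)
  have "prv (Foralls xs (Imp (Sim L (Var x) (Var y)) (Sim L (Var y) (Var x))))"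
    using SimAx[OF sim_axioms.S2] xs(2) by (simp add: x Foralls_def)
  then have "prv (substs_fm (zip xs [s, t]) (Imp (Sim L (Var x) (Var y)) (Sim L (Var y) (Var x))))"
    using xs assms by (intro prv_instance) auto
  moreover have "map (substs_tm (zip xs [s, t])) (map Var xs) = [s, t]"
    using xs by (intro substs_tm_zip) auto
  ultimately have "prv (Imp (Sim L s t) (Sim L t s))" by (simp add: x)
  then show ?thesis using assms(3) by (rule degree_MP_prv)
qed

text \<open>The two similarities need not be provable, only of degree 1; \<open>degree_conj\<close>
  passes this to the antecedent of the \<open>S3\<close> instance.\<close>

lemma degree_Sim_trans:
  assumes "wf_tm L s" "wf_tm L t" "wf_tm L u" "degree (Sim L s t) = 1" "degree (Sim L t u) = 1"
  shows "degree (Sim L s u) = 1"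
proof -
  obtain xs where xs: "length xs = 3" "distinct xs" "set xs \<inter> \<Union> (vars_tm ` set [s, t, u]) = {}"
    by (rule fresh_variables)
  then obtain x y z where x: "xs = [x, y, z]" by (auto simp: length_Suc_conv numeral_3_eq_3)
  let ?\<phi> = "Imp (Conj (Sim L (Var x) (Var y)) (Sim L (Var y) (Var z))) (Sim L (Var x) (Var z))"
  have "prv (Foralls xs ?\<phi>)"
    using SimAx[OF sim_axioms.S3] xs(2) by (simp add: x Foralls_def)
  then have "prv (substs_fm (zip xs [s, t, u]) ?\<phi>)"
    using xs assms by (intro prv_instance) auto
  moreover have "map (substs_tm (zip xs [s, t, u])) (map Var xs) = [s, t, u]"
    using xs by (intro substs_tm_zip) auto
  ultimately have "prv (Imp (Conj (Sim L s t) (Sim L t u)) (Sim L s u))" by (simp add: x)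
  then show ?thesis by (rule degree_MP_prv[OF _ degree_conj]) (use assms lang in auto)
qed

lemma equiv_tm_equiv: "equiv {t. wf_tm L t} (tm_equiv L \<Phi>)"
  by (rule equivI)
    (auto simp: tm_equiv_def refl_on_def sym_on_def trans_on_def
      intro: degree_Sim_refl degree_Sim_sym degree_Sim_trans)

lemma tm_class_eq_iff:
  "wf_tm L s \<Longrightarrow> wf_tm L t \<Longrightarrow> tm_class L \<Phi> s = tm_class L \<Phi> t \<longleftrightarrow> degree (Sim L s t) = 1"
  unfolding tm_class_def using eq_equiv_class_iff[OF equiv_tm_equiv, of s t]
  by (simp add: tm_equiv_def)

text \<open>This is the common antecedent of the instances of \<open>C1\<close> and
  \<open>C2\<close> that compare two lists of representatives.\<close>

lemma degree_Conjs_Sims: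
  assumes "list_all (wf_tm L) ss" "list_all (wf_tm L) ts"
    and "map (tm_class L \<Phi>) ss = map (tm_class L \<Phi>) ts"
  shows "degree (Conjs (map2 (Sim L) ss ts)) = 1"
proof (rule degree_Conjs)
  have len: "length ss = length ts" using assms(3) by (rule map_eq_imp_length_eq)
  fix A assume "A \<in> set (map2 (Sim L) ss ts)"
  then obtain i where i: "i < length ss" "A = Sim L (ss ! i) (ts ! i)"
    using len by (auto simp: in_set_conv_nth)
  then have "tm_class L \<Phi> (ss ! i) = tm_class L \<Phi> (ts ! i)"
    using assms(3) len by (metis nth_map)
  with i assms len show "wf A \<and> degree A = 1"
    by (simp add: lang list_all_length tm_class_eq_iff)
qed

text \<open>An instance of \<open>C1\<close> has an antecedent of degree 1, and modus ponens at
  degree 1 gives similarity of the two compound terms.\<close>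

lemma tm_class_Fn_cong:
  assumes f: "f \<in> funs L" "length ss = fun_arity L f"
    and ss: "list_all (wf_tm L) ss" "list_all (wf_tm L) ts"
      "map (tm_class L \<Phi>) ss = map (tm_class L \<Phi>) ts"
  shows "tm_class L \<Phi> (Fn f ss) = tm_class L \<Phi> (Fn f ts)"
proof -
  have len: "length ts = fun_arity L f" using f(2) map_eq_imp_length_eq[OF ss(3)] by simp
  let ?\<phi> = "\<lambda>xs ys. Imp (Conjs (map2 (\<lambda>x y. Sim L (Var x) (Var y)) xs ys))
    (Sim L (Fn f (map Var xs)) (Fn f (map Var ys)))"
  obtain xs ys \<sigma> where i: "prv (substs_fm \<sigma> (?\<phi> xs ys))" "length xs = fun_arity L f"
    "length ys = fun_arity L f" "map (substs_tm \<sigma> \<circ> Var) xs = ss" "map (substs_tm \<sigma> \<circ> Var) ys = ts"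
    by (rule prv_instance2[of "fun_arity L f" ?\<phi> ss ts])
      (use f ss len in \<open>auto intro!: SimAx sim_axioms.C1 quantifier_free_Conjs\<close>)
  then have "prv (Imp (Conjs (map2 (Sim L) ss ts)) (Sim L (Fn f ss) (Fn f ts)))"
    \<comment> \<open>Fusing the nested maps at once would destroy the pattern of
      \<open>map_substs_Sims\<close>; the second call fuses them.\<close>
    by (simp del: map_map add: map_substs_Sims) (simp)
  from degree_MP_prv[OF this degree_Conjs_Sims[OF ss]] show ?thesis
    using f ss len by (subst tm_class_eq_iff) auto
qed

text \<open>\<open>C2\<close> gives the equivalence degree 1, hence both implications, and
  \<open>degree_mono\<close> compares the degrees in each direction.\<close>

lemma degree_Pred_cong:
  assumes p: "p \<in> preds L" "length ss = pred_arity L p"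
    and ss: "list_all (wf_tm L) ss" "list_all (wf_tm L) ts"
      "map (tm_class L \<Phi>) ss = map (tm_class L \<Phi>) ts"
  shows "degree (Pred p ss) = degree (Pred p ts)"
proof -
  have len: "length ts = pred_arity L p" using p(2) map_eq_imp_length_eq[OF ss(3)] by simp
  let ?\<phi> = "\<lambda>xs ys. Imp (Conjs (map2 (\<lambda>x y. Sim L (Var x) (Var y)) xs ys))
    (Iff (Pred p (map Var xs)) (Pred p (map Var ys)))"
  obtain xs ys \<sigma> where i: "prv (substs_fm \<sigma> (?\<phi> xs ys))" "length xs = pred_arity L p"
    "length ys = pred_arity L p" "map (substs_tm \<sigma> \<circ> Var) xs = ss" "map (substs_tm \<sigma> \<circ> Var) ys = ts"
    by (rule prv_instance2[of "pred_arity L p" ?\<phi> ss ts])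
      (use p ss len in \<open>auto intro!: SimAx sim_axioms.C2 quantifier_free_Conjs\<close>)
  then have "prv (Imp (Conjs (map2 (Sim L) ss ts)) (Iff (Pred p ss) (Pred p ts)))"
    by (simp del: map_map add: map_substs_Sims) (simp)
  then have iff: "degree (Iff (Pred p ss) (Pred p ts)) = 1"
    using degree_MP_prv degree_Conjs_Sims[OF ss] by blast
  have wfs: "wf (Pred p ss)" "wf (Pred p ts)" using p ss len by auto
  show ?thesis
  proof (rule antisym)
    show "degree (Pred p ss) \<le> degree (Pred p ts)"
      using wfs iff by (intro degree_mono degree_MP_prv[OF prv_conjE1 iff[unfolded Iff_def]]) auto
    show "degree (Pred p ts) \<le> degree (Pred p ss)"
      using wfs iff by (intro degree_mono degree_MP_prv[OF prv_conjE2 iff[unfolded Iff_def]]) auto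
  qed
qed

section \<open>Operations and domain of the term structure\<close>

lemma finterp_term_structure:
  assumes "f \<in> funs L" "length ts = fun_arity L f" "list_all (wf_tm L) ts"
  shows "finterp (term_structure L \<Phi>) f (map (tm_class L \<Phi>) ts) = tm_class L \<Phi> (Fn f ts)"
  unfolding term_structure_def fstruct.simps
proof (rule the_equality)
  fix c assume "\<exists>ss. list_all (wf_tm L) ss \<and> map (tm_class L \<Phi>) ss = map (tm_class L \<Phi>) ts \<and>
    c = tm_class L \<Phi> (Fn f ss)"
  \<comment> \<open>Other representatives give the same class, so the description is
    determined.\<close>
  then show "c = tm_class L \<Phi> (Fn f ts)" using tm_class_Fn_cong[OF assms] by metis
qed (use assms in blast)

lemma pinterp_term_structure:
  assumes "p \<in> preds L" "length ts = pred_arity L p" "list_all (wf_tm L) ts"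
  shows "pinterp (term_structure L \<Phi>) p (map (tm_class L \<Phi>) ts) = degree (Pred p ts)"
  unfolding term_structure_def fstruct.simps
proof (rule the_equality)
  fix a assume "\<exists>ss. list_all (wf_tm L) ss \<and> map (tm_class L \<Phi>) ss = map (tm_class L \<Phi>) ts \<and>
    a = degree (Pred p ss)"
  then show "a = degree (Pred p ts)" using degree_Pred_cong[OF assms] by metis
qed (use assms in blast)

lemma dom_term_structure: "dom (term_structure L \<Phi>) = tm_class L \<Phi> ` {t. wf_tm L t}"
  by (auto simp: term_structure_def quotient_def tm_class_def)

lemma dom_term_structure_listE:
  assumes "set cs \<subseteq> dom (term_structure L \<Phi>)"
  obtains ts where "list_all (wf_tm L) ts" "cs = map (tm_class L \<Phi>) ts"
proof -
  have "\<exists>ts. list_all (wf_tm L) ts \<and> cs = map (tm_class L \<Phi>) ts"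
    using assms
  proof (induction cs)
    case (Cons c cs)
    then obtain t ts where "wf_tm L t" "c = tm_class L \<Phi> t" "list_all (wf_tm L) ts"
      "cs = map (tm_class L \<Phi>) ts" by (auto simp: dom_term_structure)
    then show ?case by (intro exI[of _ "t # ts"]) simp
  qed simp
  then show thesis using that by blast
qed

section \<open>Homomorphisms out of the term structure\<close>

lemma fm_value_of_degree_eq_1:
  assumes "is_model L \<Phi> N" "v \<in> evaluations N" "wf A" "degree A = 1"
  shows "fm_value N v A = 1"
proof -
  \<comment> \<open>By soundness each provable level \<open>r\<close> lies below the value in
    \<open>N\<close>, and so does the supremum of these levels.\<close>
  have "degree A \<le> fm_value N v A"
  proof (rule degree_least[OF assms(3)])
    fix r assume "prv (Imp (TConst r) A)"
    from soundness[OF lang thy assms(1) this assms(2)] show "real_of_rat r \<le> fm_value N v A"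
      by (simp add: luk_imp_eq_1_iff)
  qed
  moreover have "is_structure L N" using assms(1) by (simp add: is_model_def)
  ultimately show ?thesis using fm_value_bounds[OF _ assms(3,2)] assms(4) by force
qed

text \<open>Every class arises from classes of variables by the operations, with which
  \<open>g\<close> commutes; induction on terms propagates the values of \<open>v\<close>.\<close>

lemma term_structure_hom_unique:
  assumes "is_hom L (term_structure L \<Phi>) N g" "\<And>x. g (tm_class L \<Phi> (Var x)) = v x"
  shows "wf_tm L t \<Longrightarrow> g (tm_class L \<Phi> t) = tm_value N v t"
proof (induction t)
  case (Fn f ts)
  then have "g (tm_class L \<Phi> (Fn f ts)) = finterp N f (map g (map (tm_class L \<Phi>) ts))"
    using assms(1) finterp_term_structure[of f ts]
    by (auto simp: is_hom_def dom_term_structure list_all_iff simp del: map_map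
        dest!: bspec[of _ _ f] spec[of _ "map (tm_class L \<Phi>) ts"])
  also have "map g (map (tm_class L \<Phi>) ts) = map (tm_value N v) ts"
    using Fn by (auto simp: list_all_iff)
  finally show ?case by simp
qed (use assms in simp)

lemma term_structure_hom_exists:
  assumes N: "is_model L \<Phi> N" "reduced L N" and v: "v \<in> evaluations N"
  shows "\<exists>g. is_hom L (term_structure L \<Phi>) N g \<and> (\<forall>x. g (tm_class L \<Phi> (Var x)) = v x)"
proof -
  let ?T = "term_structure L \<Phi>"
  have str: "is_structure L N" using N(1) by (simp add: is_model_def)
  \<comment> \<open>An arbitrary representative is evaluated; the restriction makes \<open>g\<close>
    \<open>undefined\<close> off the domain, as \<open>is_hom\<close> demands.\<close>
  define g where "g = (\<lambda>c\<in>dom ?T. tm_value N v (SOME t. wf_tm L t \<and> tm_class L \<Phi> t = c))"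
  have val: "tm_value N v t \<in> dom N" if "wf_tm L t" for t
    using that tm_value_in_dom[OF str v] by blast
  have g: "g (tm_class L \<Phi> t) = tm_value N v t" if t: "wf_tm L t" for t
  proof -
    define s where "s = (SOME s. wf_tm L s \<and> tm_class L \<Phi> s = tm_class L \<Phi> t)"
    have s: "wf_tm L s \<and> tm_class L \<Phi> s = tm_class L \<Phi> t"
      unfolding s_def by (rule someI[of _ t]) (use t in simp)
    then have "fm_value N v (Sim L s t) = 1"
      using t lang by (intro fm_value_of_degree_eq_1[OF N(1) v]) (auto simp: tm_class_eq_iff)
    \<comment> \<open>Here reducedness turns similarity of value 1 into equality, so the choice of
      representative is immaterial.\<close>
    then have "tm_value N v s = tm_value N v t"
      using N(2) s t val by (auto simp: Sim_def reduced_def)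
    then show ?thesis using t by (simp add: g_def dom_term_structure flip: s_def)
  qed
  have gmap: "map g (map (tm_class L \<Phi>) ts) = map (tm_value N v) ts" if "list_all (wf_tm L) ts" for ts
    using that g by (auto simp: list_all_iff)
  have "is_hom L ?T N g"
    unfolding is_hom_def
  proof (intro conjI ballI allI impI; (elim conjE)?)
    have "g \<in> extensional (dom ?T)" by (simp add: g_def)
    moreover have "g c \<in> dom N" if "c \<in> dom ?T" for c
      using that g val by (auto simp: dom_term_structure)
    ultimately show "g \<in> dom ?T \<rightarrow>\<^sub>E dom N" by (simp add: PiE_iff)
  next
    fix f cs assume f: "f \<in> funs L" "set cs \<subseteq> dom ?T" "length cs = fun_arity L f"
    obtain ts where ts: "list_all (wf_tm L) ts" "cs = map (tm_class L \<Phi>) ts"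
      by (rule dom_term_structure_listE[OF f(2)])
    have "g (finterp ?T f cs) = tm_value N v (Fn f ts)"
      using f ts by (simp add: finterp_term_structure g)
    then show "g (finterp ?T f cs) = finterp N f (map g cs)"
      using gmap[OF ts(1)] unfolding ts(2) by (simp only: tm_value.simps)
  next
    fix p cs assume p: "p \<in> preds L" "set cs \<subseteq> dom ?T" "length cs = pred_arity L p"
      and 1: "pinterp ?T p cs = 1"
    obtain ts where ts: "list_all (wf_tm L) ts" "cs = map (tm_class L \<Phi>) ts"
      by (rule dom_term_structure_listE[OF p(2)])
    \<comment> \<open>Value 1 in the term structure is provability degree 1, which transfers to
      every model.\<close>
    have "degree (Pred p ts) = 1" using 1 p ts by (simp add: pinterp_term_structure)
    then have "fm_value N v (Pred p ts) = 1"
      using p ts by (intro fm_value_of_degree_eq_1[OF N(1) v]) auto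
    then show "pinterp N p (map g cs) = 1"
      using gmap[OF ts(1)] unfolding ts(2) by (simp only: fm_value.simps)
  qed
  then show ?thesis using g by auto
qed

end

theorem theorem2:
  fixes L :: "('f, 'p) language"
    and \<Phi> :: "('f, 'p) fm set"
    and N :: "('f, 'p, 'n) fstruct"
    and v :: "nat \<Rightarrow> 'n"
  assumes "is_language L"
    and "is_theory L \<Phi>"
    and "consistent L \<Phi>"
    and "is_model L \<Phi> (term_structure L \<Phi>)"
    and "is_model L \<Phi> N"
    and "reduced L N"
    and "v \<in> evaluations N"
  shows "\<exists>!g. is_hom L (term_structure L \<Phi>) N g \<and>
    (\<forall>x. g (tm_class L \<Phi> (Var x)) = v x)"
proof (rule ex_ex1I)
  interpret rpl_theory L \<Phi> by unfold_locales fact+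
  show "\<exists>g. is_hom L (term_structure L \<Phi>) N g \<and> (\<forall>x. g (tm_class L \<Phi> (Var x)) = v x)"
    by (rule term_structure_hom_exists) fact+
  fix g h
  assume g: "is_hom L (term_structure L \<Phi>) N g \<and> (\<forall>x. g (tm_class L \<Phi> (Var x)) = v x)"
    and h: "is_hom L (term_structure L \<Phi>) N h \<and> (\<forall>x. h (tm_class L \<Phi> (Var x)) = v x)"
  have "g \<in> dom (term_structure L \<Phi>) \<rightarrow>\<^sub>E dom N" "h \<in> dom (term_structure L \<Phi>) \<rightarrow>\<^sub>E dom N"
    using g h by (simp_all add: is_hom_def)
  then show "g = h"
  \<comment> \<open>Both maps are \<open>undefined\<close> off the domain, so agreement on classes
    of terms suffices.\<close>
  proof (rule PiE_ext)
    fix c assume "c \<in> dom (term_structure L \<Phi>)"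
    then obtain t where "wf_tm L t" "c = tm_class L \<Phi> t" by (auto simp: dom_term_structure)
    then show "g c = h c"
      using g h term_structure_hom_unique[of N g v t] term_structure_hom_unique[of N h v t] by simp
  qed
qed

end
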